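(* For each integer $t\ge 1$ let $M_{\mathrm c}(t)$ be the number of $3\times 3$ magic squares all of whose entries are strictly between $0$ and $t$. Then $$\sum_{t>0} M_{\mathrm c}(t)\,x^t=\frac{8x^{10}(2x^2+1)}{(1-x)^2(1-x^4)(1-x^6)},$$ and for every integer $t\ge 1$ $$M_{\mathrm c}(t)=\begin{cases} \frac{t^3-16t^2+76t-96}{6}, & t\equiv 0,2,6,8 \pmod{12},\\[2pt] \frac{t^3-16t^2+73t-58}{6}, & t\equiv 1 \pmod{12},\\[2pt] \frac{t^3-16t^2+73t-102}{6}, & t\equiv 3,11 \pmod{12},\\[2pt] \frac{t^3-16t^2+76t-112}{6}, & t\equiv 4,10 \pmod{12},\\[2pt] \frac{t^3-16t^2+73t-90}{6}, & t\equiv 5,9 \pmod{12},\\[2pt] \frac{t^3-16t^2+73t-70}{6}, & t\equiv 7 \pmod{12}. \end{cases}$$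
   Context: A $3\times3$ magic square (in the strong sense) is a $3\times 3$ matrix of pairwise distinct positive integers in which all three row sums, all three column sums and both diagonal sums are equal. Squares are counted as matrices (not up to symmetry). *)

theory Defs
  imports "HOL-Analysis.Analysis" "HOL-Computational_Algebra.Formal_Power_Series"
begin

text \<open>
  The index type \<^typ>\<open>3\<close> has exactly the three elements \<open>1, 2, 3\<close> (with \<open>3 = 0\<close>), so the
  second diagonal of a \<open>3 \<times> 3\<close> matrix consists of the entries at \<open>(1,3), (2,2), (3,1)\<close>.
\<close>

definition magic_square :: "int ^ 3 ^ 3 \<Rightarrow> bool" where
  "magic_square A \<longleftrightarrow>
     (\<forall>i j. 0 < A $ i $ j) \<and>
     inj (\<lambda>(i, j). A $ i $ j) \<and>
     (\<exists>s. (\<forall>i. (\<Sum>j\<in>UNIV. A $ i $ j) = s) \<and>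
          (\<forall>j. (\<Sum>i\<in>UNIV. A $ i $ j) = s) \<and>
          A $ 1 $ 1 + A $ 2 $ 2 + A $ 3 $ 3 = s \<and>
          A $ 1 $ 3 + A $ 2 $ 2 + A $ 3 $ 1 = s)"

definition cubic_magic_squares :: "nat \<Rightarrow> (int ^ 3 ^ 3) set" where
  "cubic_magic_squares t =
     {A. magic_square A \<and> (\<forall>i j. 0 < A $ i $ j \<and> A $ i $ j < int t)}"

definition M_c :: "nat \<Rightarrow> nat" where
  "M_c t = card (cubic_magic_squares t)"

lemma finite_vec_entries:
  assumes "finite S"
  shows "finite {v :: 'a ^ 'n. \<forall>i. v $ i \<in> S}"
proof (rule finite_imageD)
  show "finite (vec_nth ` {v :: 'a ^ 'n. \<forall>i. v $ i \<in> S})"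
  proof (rule finite_subset)
    show "vec_nth ` {v :: 'a ^ 'n. \<forall>i. v $ i \<in> S} \<subseteq> PiE UNIV (\<lambda>_. S)"
      by auto
    show "finite (PiE (UNIV :: 'n set) (\<lambda>_. S))"
      using assms by (intro finite_PiE) simp_all
  qed
  show "inj_on vec_nth {v :: 'a ^ 'n. \<forall>i. v $ i \<in> S}"
    by (simp add: inj_on_def vec_nth_inject)
qed

lemma finite_cubic_magic_squares: "finite (cubic_magic_squares t)"
proof (rule finite_subset)
  show "cubic_magic_squares t \<subseteq> {A. \<forall>i. A $ i \<in> {v. \<forall>j. v $ j \<in> {0<..<int t}}}"
    by (simp add: cubic_magic_squares_def subset_iff)
  show "finite {A :: int ^ 3 ^ 3. \<forall>i. A $ i \<in> {v. \<forall>j. v $ j \<in> {0<..<int t}}}"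
    by (intro finite_vec_entries) simp
qed

end

(* A magic square with centre c is determined by its top corners c + a and c + b. Its entries are
   distinct iff a, b, a + b, a - b are nonzero and pairwise distinct up to sign, and they lie
   strictly between 0 and t iff |a| + |b| < min c (t - c). Up to eight sign changes and swaps we may
   take a > b > 0. The number h(s) of such pairs with a + b = s and a \<noteq> 2b is
   floor((s-1)/2) - [3 | s], and there are max(t - 1 - 2s, 0) admissible centres for each, so
   M_c(t) = 8 * sum_s h(s) max(t - 1 - 2s, 0). The second difference of M_c is thus 8 h(s) at
   t = 2s and 0 at odd t. Together with h(s+5) - h(s+3) - h(s+2) + h(s) = 0 for s > 0 this gives
   the generating function, and comparing second differences gives the quasipolynomial. *)

theory Submission
  imports Defs
begin

section \<open>Parametrising squares by top corners and centre\<close>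

definition square_of :: "int \<times> int \<times> int \<Rightarrow> int ^ 3 ^ 3" where
  "square_of = (\<lambda>(a, b, c).
     vector [vector [c + a, c - a - b, c + b],
             vector [c - a + b, c, c + a - b],
             vector [c - b, c + a + b, c - a]])"

text \<open>Collisions among 0, a, b, a + b, a - b up to sign reduce to these conditions: for
  example a = -(a + b) means b = -2 a, and |a + b| = |a - b| means that a or b is 0. Absolute values
  make the invariance under sign changes and the swap visible.\<close>

definition params :: "nat \<Rightarrow> (int \<times> int \<times> int) set" where
  "params t = {(a, b, c). a \<noteq> 0 \<and> b \<noteq> 0 \<and> \<bar>a\<bar> \<noteq> \<bar>b\<bar> \<and> \<bar>a\<bar> \<noteq> 2 * \<bar>b\<bar> \<and> \<bar>b\<bar> \<noteq> 2 * \<bar>a\<bar> \<and>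
     \<bar>a\<bar> + \<bar>b\<bar> < c \<and> c < int t - (\<bar>a\<bar> + \<bar>b\<bar>)}"

lemma square_of_mem:
  assumes "(a, b, c) \<in> params t"
  shows "square_of (a, b, c) \<in> cubic_magic_squares t"
proof -
  have "\<bar>a\<bar> + \<bar>b\<bar> < c" "c < int t - (\<bar>a\<bar> + \<bar>b\<bar>)"
    using assms by (simp_all add: params_def)
  then have bounds: "\<forall>i j. 0 < square_of (a, b, c) $ i $ j \<and> square_of (a, b, c) $ i $ j < int t"
    unfolding forall_3 square_of_def by simp linarith
  have "inj (\<lambda>(i, j). square_of (a, b, c) $ i $ j)"
    using assms by (auto simp: inj_def forall_3 square_of_def params_def)
  then show ?thesis
    using bounds
    by (auto simp: cubic_magic_squares_def magic_square_def forall_3 sum_3 square_of_def)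
qed

lemma square_of_inverse:
  assumes "A \<in> cubic_magic_squares t"
  shows "(A $ 1 $ 1 - A $ 2 $ 2, A $ 1 $ 3 - A $ 2 $ 2, A $ 2 $ 2) \<in> params t"
    and "square_of (A $ 1 $ 1 - A $ 2 $ 2, A $ 1 $ 3 - A $ 2 $ 2, A $ 2 $ 2) = A"
proof -
  define a b c where abc: "a = A $ 1 $ 1 - A $ 2 $ 2" "b = A $ 1 $ 3 - A $ 2 $ 2" "c = A $ 2 $ 2"
  obtain s where "A $ 1 $ 1 + A $ 1 $ 2 + A $ 1 $ 3 = s" "A $ 2 $ 1 + A $ 2 $ 2 + A $ 2 $ 3 = s"
    "A $ 3 $ 1 + A $ 3 $ 2 + A $ 3 $ 3 = s" "A $ 1 $ 1 + A $ 2 $ 1 + A $ 3 $ 1 = s"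
    "A $ 1 $ 2 + A $ 2 $ 2 + A $ 3 $ 2 = s" "A $ 1 $ 3 + A $ 2 $ 3 + A $ 3 $ 3 = s"
    "A $ 1 $ 1 + A $ 2 $ 2 + A $ 3 $ 3 = s" "A $ 1 $ 3 + A $ 2 $ 2 + A $ 3 $ 1 = s"
    using assms by (auto simp: cubic_magic_squares_def magic_square_def forall_3 sum_3)
  \<comment> \<open>The four lines through the centre cover every other entry once and the centre
    four times, so 4 s = 3 s + 3 c. Hence s = 3 c, and opposite entries add up to 2 c.\<close>
  then have entries:
    "A $ 1 $ 1 = c + a" "A $ 1 $ 2 = c - a - b" "A $ 1 $ 3 = c + b"
    "A $ 2 $ 1 = c - a + b" "A $ 2 $ 2 = c" "A $ 2 $ 3 = c + a - b"
    "A $ 3 $ 1 = c - b" "A $ 3 $ 2 = c + a + b" "A $ 3 $ 3 = c - a"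
    unfolding abc by linarith+
  have inj: "A $ i $ j \<noteq> A $ k $ l" if "(i, j) \<noteq> (k, l)" for i j k l
    using assms that by (auto simp: cubic_magic_squares_def magic_square_def inj_def)
  have bounds: "\<forall>i j. 0 < A $ i $ j \<and> A $ i $ j < int t"
    using assms by (auto simp: cubic_magic_squares_def)
  \<comment> \<open>The extreme entries are c - (|a| + |b|) and c + (|a| + |b|), because |a| + |b|
    is the larger of |a + b| and |a - b|.\<close>
  have "\<bar>a\<bar> + \<bar>b\<bar> < c \<and> c < int t - (\<bar>a\<bar> + \<bar>b\<bar>)"
    using bounds unfolding forall_3 entries by linarith
  \<comment> \<open>One pair of cells for each inequality, in the same order.\<close>
  moreover have "a \<noteq> 0" "b \<noteq> 0" "a \<noteq> b" "a \<noteq> - b" "a \<noteq> 2 * b" "a \<noteq> - 2 * b" "b \<noteq> 2 * a" "b \<noteq> - 2 * a"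
    using inj[of 1 1 2 2] inj[of 1 3 2 2] inj[of 1 1 1 3] inj[of 1 1 3 1]
      inj[of 1 3 2 3] inj[of 1 2 1 3] inj[of 1 1 2 1] inj[of 1 2 1 1]
    by (simp_all add: entries)
  ultimately have "(a, b, c) \<in> params t"
    by (auto simp: params_def abs_if split: if_splits)
  then show "(A $ 1 $ 1 - A $ 2 $ 2, A $ 1 $ 3 - A $ 2 $ 2, A $ 2 $ 2) \<in> params t"
    by (simp add: abc)
  have "square_of (a, b, c) = A"
    by (simp add: vec_eq_iff forall_3 square_of_def entries)
  then show "square_of (A $ 1 $ 1 - A $ 2 $ 2, A $ 1 $ 3 - A $ 2 $ 2, A $ 2 $ 2) = A"
    by (simp add: abc)
qed

lemma M_c_eq_card_params: "M_c t = card (params t)"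
proof -
  have "bij_betw (\<lambda>A. (A $ 1 $ 1 - A $ 2 $ 2, A $ 1 $ 3 - A $ 2 $ 2, A $ 2 $ 2))
      (cubic_magic_squares t) (params t)"
    by (rule bij_betw_byWitness[where f' = square_of])
      (auto simp: square_of_inverse square_of_mem, auto simp: square_of_def)
  then show ?thesis
    unfolding M_c_def by (rule bij_betw_same_card)
qed

section \<open>Reduction to pairs with a > b > 0\<close>

text \<open>The possible smaller parts \<open>b\<close> of \<open>s = a + b\<close> with \<open>a > b > 0\<close> and \<open>a \<noteq> 2 * b\<close>.\<close>

definition smaller_parts :: "nat \<Rightarrow> int set" where
  "smaller_parts s = {b. 0 < b \<and> 2 * b < int s \<and> int s \<noteq> 3 * b}"

text \<open>Truncated subtraction is harmless: \<open>num_parts 0 = 0\<close>.\<close>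

definition num_parts :: "nat \<Rightarrow> nat" where
  "num_parts s = (s - 1) div 2 - (if 3 dvd s then 1 else 0)"

lemma smaller_parts_alt:
  "smaller_parts s = {1..int ((s - 1) div 2)} - (if 3 dvd s then {int (s div 3)} else {})"
  by (auto simp: smaller_parts_def) presburger+

lemma card_smaller_parts: "card (smaller_parts s) = num_parts s"
\<comment> \<open>At s = 0 the removed point 0 lies outside the empty interval, so no element is
  lost; the truncated 0 - 1 = 0 agrees with this.\<close>
proof (cases "3 dvd s \<and> s > 0")
  case True
  then have "int (s div 3) \<in> {1..int ((s - 1) div 2)}"
    by auto
  with True show ?thesis
    by (simp add: smaller_parts_alt num_parts_def)
qed (auto simp: smaller_parts_alt num_parts_def)

lemma finite_smaller_parts: "finite (smaller_parts s)"
  by (simp add: smaller_parts_alt)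

text \<open>Cutting off at s < t loses nothing: a centre exists only if 2 s + 1 < t.\<close>

definition reduced_params :: "nat \<Rightarrow> (nat \<times> int \<times> int) set" where
  "reduced_params t = (SIGMA s:{..<t}. smaller_parts s \<times> {int s + 1..<int t - int s})"

lemma card_reduced_params: "card (reduced_params t) = (\<Sum>s<t. num_parts s * (t - (2 * s + 1)))"
proof -
  have "nat (int t - int s - (int s + 1)) = t - (2 * s + 1)" for s
    by linarith
  then show ?thesis
    unfolding reduced_params_def
    by (subst card_SigmaI) (simp_all add: finite_smaller_parts card_cartesian_product card_smaller_parts)
qed

text \<open>The sign changes and the swap form a group of order 8. It acts freely here, since a and
  b are nonzero and |a| \<noteq> |b|, so every orbit has exactly 8 elements.\<close>

lemma card_params: "card (params t) = 8 * card (reduced_params t)"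
proof -
  let ?sg = "\<lambda>p x. if p then - x else x :: int"
  let ?f = "\<lambda>(a, b, c). ((a < 0, b < 0, \<bar>a\<bar> < \<bar>b\<bar>), nat (\<bar>a\<bar> + \<bar>b\<bar>), min \<bar>a\<bar> \<bar>b\<bar>, c)"
  let ?g = "\<lambda>((p, q, r), s, b, c). if r then (?sg p b, ?sg q (int s - b), c)
              else (?sg p (int s - b), ?sg q b, c)"
  \<comment> \<open>The boolean triple records the two signs and which of \<open>\<bar>a\<bar>\<close>, \<open>\<bar>b\<bar>\<close> is smaller.\<close>
  have "bij_betw ?f (params t) (UNIV \<times> reduced_params t)"
  proof (rule bij_betw_byWitness[where f' = ?g])
    show "\<forall>x\<in>params t. ?g (?f x) = x"
      by (auto simp: params_def)
    show "\<forall>y\<in>UNIV \<times> reduced_params t. ?f (?g y) = y"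
      by (auto simp: reduced_params_def smaller_parts_def)
    have "(nat (\<bar>a\<bar> + \<bar>b\<bar>), min \<bar>a\<bar> \<bar>b\<bar>, c) \<in> reduced_params t" if "(a, b, c) \<in> params t" for a b c
    proof -
      define x y where "x = \<bar>a\<bar>" and "y = \<bar>b\<bar>"
      have "x > 0" "y > 0" "x \<noteq> y" "x \<noteq> 2 * y" "y \<noteq> 2 * x" "x + y < c" "c < int t - (x + y)"
        using that by (auto simp: params_def x_def y_def)
      then have "(nat (x + y), min x y, c) \<in> reduced_params t"
        by (cases "x < y") (simp_all add: reduced_params_def smaller_parts_def nat_less_iff)
      then show ?thesis
        by (simp only: x_def y_def)
    qed
    then show "?f ` params t \<subseteq> UNIV \<times> reduced_params t"
      by auto
    have g_mem: "?g ((p, q, r), s, b, c) \<in> params t" if "(s, b, c) \<in> reduced_params t" for p q r s b c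
      using that by (cases p; cases q; cases r) (auto simp: reduced_params_def smaller_parts_def params_def)
    show "?g ` (UNIV \<times> reduced_params t) \<subseteq> params t"
    proof (rule image_subsetI)
      fix y :: "(bool \<times> bool \<times> bool) \<times> nat \<times> int \<times> int"
      assume "y \<in> UNIV \<times> reduced_params t"
      then obtain p q r s b c where "y = ((p, q, r), s, b, c)" "(s, b, c) \<in> reduced_params t"
        by (metis mem_Times_iff prod.collapse)
      then show "?g y \<in> params t"
        using g_mem by blast
    qed
  qed
  then have "card (params t) = card ((UNIV :: (bool \<times> bool \<times> bool) set) \<times> reduced_params t)"
    by (rule bij_betw_same_card)
  then show ?thesis
    by (simp add: card_cartesian_product card_UNIV_bool flip: UNIV_Times_UNIV)
qed

lemma M_c_eq_sum: "M_c t = 8 * (\<Sum>s<t. num_parts s * (t - (2 * s + 1)))"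
  by (simp add: M_c_eq_card_params card_params card_reduced_params)

section \<open>Second differences and the quasipolynomial\<close>

text \<open>For fixed s the truncated factor is a ramp in t, flat up to 2 s + 1 and of slope 1
  afterwards. Its second difference is 1 at t = 2 s and 0 elsewhere.\<close>

lemma M_c_second_difference:
  "M_c (t + 2) + M_c t = 2 * M_c (t + 1) + 8 * (if even t then num_parts (t div 2) else 0)"
proof -
  \<comment> \<open>Brings the three sums to a common range; the added terms have s \<ge> u, where
    \<open>u - (2 * s + 1)\<close> truncates to 0.\<close>
  have ext: "M_c u = 8 * (\<Sum>s<t + 2. num_parts s * (u - (2 * s + 1)))" if "u \<le> t + 2" for u
    unfolding M_c_eq_sum
    using that by (intro arg_cong[where f = "\<lambda>x. 8 * x"] sum.mono_neutral_left) auto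
  have "(\<Sum>s<t + 2. num_parts s * (t + 2 - (2 * s + 1))) + (\<Sum>s<t + 2. num_parts s * (t - (2 * s + 1)))
      = (\<Sum>s<t + 2. 2 * (num_parts s * (t + 1 - (2 * s + 1))) + (if s = t div 2 then (if even t then num_parts s else 0) else 0))"
    unfolding sum.distrib[symmetric]
  proof (rule sum.cong)
    fix s
    have "t + 2 - (2 * s + 1) + (t - (2 * s + 1))
        = 2 * (t + 1 - (2 * s + 1)) + (if s = t div 2 \<and> even t then 1 else 0)"
    proof (cases "even t")
      case True
      then obtain u where "t = 2 * u"
        by (elim evenE)
      then show ?thesis
        by (cases s u rule: linorder_cases) auto
    next
      case False
      then obtain u where "t = 2 * u + 1"
        by (elim oddE)
      then show ?thesis
        by (cases "s \<le> u") auto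
    qed
    then have "num_parts s * (t + 2 - (2 * s + 1) + (t - (2 * s + 1)))
        = num_parts s * (2 * (t + 1 - (2 * s + 1)) + (if s = t div 2 \<and> even t then 1 else 0))"
      by (rule arg_cong)
    then show "num_parts s * (t + 2 - (2 * s + 1)) + num_parts s * (t - (2 * s + 1))
      = 2 * (num_parts s * (t + 1 - (2 * s + 1))) + (if s = t div 2 then (if even t then num_parts s else 0) else 0)"
      by (auto simp: distrib_left split: if_splits)
  qed simp
  also have "\<dots> = 2 * (\<Sum>s<t + 2. num_parts s * (t + 1 - (2 * s + 1))) + (if even t then num_parts (t div 2) else 0)"
  proof -
    have "t div 2 < t + 2"
      by simp
    then show ?thesis
      by (simp add: sum.distrib sum_distrib_left del: sum.lessThan_Suc add_2_eq_Suc')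
  qed
  finally show ?thesis
    using ext[of t] ext[of "t + 1"] ext[of "t + 2"] by linarith
qed

text \<open>Positivity of j matters: the value that would continue the pattern to j = 0 is
  floor(-1/2) - 1 = -2, while \<open>num_parts 0 = 0\<close>. This is the origin of the -2 in
  \<open>num_parts_mult_6\<close>.\<close>

lemma num_parts_add_mult_6:
  assumes "j > 0"
  shows "num_parts (6 * k + j) = 3 * k + num_parts j"
proof -
  have half: "(6 * k + j - 1) div 2 = 3 * k + (j - 1) div 2"
    using assms by (cases j) auto
  have dvd: "3 dvd 6 * k + j \<longleftrightarrow> 3 dvd j"
    using dvd_add_right_iff[of 3 "6 * k" j] by simp
  have "(j - 1) div 2 \<ge> 1" if "3 dvd j"
    using that assms by (auto elim: dvdE)
  then show ?thesis
    unfolding num_parts_def half dvd by auto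
qed

lemma num_parts_mult_6: "num_parts (6 * k) = 3 * k - 2"
proof (cases k)
  case (Suc m)
  then have "num_parts (6 * k) = num_parts (6 * m + 6)"
    by (simp add: algebra_simps)
  also have "\<dots> = 3 * k - 2"
    using Suc by (simp only: num_parts_add_mult_6) (simp add: num_parts_def)
  finally show ?thesis .
qed (simp add: num_parts_def)

text \<open>\<open>r\<close> is the residue of \<open>x\<close> modulo 12, passed separately so that it can be evaluated.\<close>

definition class_poly :: "rat \<Rightarrow> nat \<Rightarrow> rat" where
  "class_poly x r =
     (x ^ 3 - 16 * x ^ 2 + (if r \<in> {0, 2, 4, 6, 8, 10} then 76 else 73) * x -
      (if r \<in> {0, 2, 6, 8} then 96 else if r = 1 then 58 else if r \<in> {3, 11} then 102
       else if r \<in> {4, 10} then 112 else if r \<in> {5, 9} then 90 else 70)) / 6"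

definition quasi_poly :: "nat \<Rightarrow> rat" where
  "quasi_poly t = class_poly (of_nat t) (t mod 12)"

text \<open>With K a rational unknown, each of the twelve residues gives a polynomial identity in K.
  The residue wraps around for r = 10 and r = 11, while the first argument keeps growing.\<close>

lemma class_poly_second_difference:
  assumes "r < 12"
  shows "class_poly (12 * K + of_nat (r + 2)) ((r + 2) mod 12)
      = 2 * class_poly (12 * K + of_nat (r + 1)) ((r + 1) mod 12)
        - class_poly (12 * K + of_nat r) (r mod 12)
        + 8 * (if even r then if r = 0 then 3 * K - 2 else 3 * K + of_nat (num_parts (r div 2)) else 0)"
proof -
  from assms have "r \<in> {0,1,2,3,4,5,6,7,8,9,10,11}"
    by (simp add: eval_nat_numeral less_Suc_eq)
  then show ?thesis
    by (elim insertE emptyE; hypsubst)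
      (simp_all add: class_poly_def num_parts_def, simp_all add: power2_eq_square power3_eq_cube field_simps)
qed

text \<open>The case t = 0 is a genuine exception: \<open>quasi_poly 0\<close> is -16, whereas
  \<open>M_c 0 = 0\<close>.\<close>

lemma quasi_poly_second_difference:
  assumes "t > 0"
  shows "quasi_poly (t + 2) = 2 * quasi_poly (t + 1) - quasi_poly t
     + 8 * (if even t then of_nat (num_parts (t div 2)) else 0)"
proof -
  obtain k r where t: "t = 12 * k + r" and "r < 12"
    by (metis mod_less_divisor mult_div_mod_eq zero_less_numeral)
  have shift: "quasi_poly (12 * k + j) = class_poly (12 * of_nat k + of_nat j) (j mod 12)" for j
    by (simp add: quasi_poly_def)
  have "rat_of_nat (num_parts (t div 2))
      = (if r = 0 then 3 * of_nat k - 2 else 3 * of_nat k + of_nat (num_parts (r div 2)))"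
    if "even r"
  proof (cases "r = 0")
    case True
    then have "t div 2 = 6 * k" and "k > 0"
      using assms t by auto
    with True show ?thesis
      by (simp add: num_parts_mult_6 of_nat_diff)
  next
    case False
    then have "r div 2 > 0" and "t div 2 = 6 * k + r div 2"
      using \<open>even r\<close> t by auto
    with False show ?thesis
      by (simp add: num_parts_add_mult_6)
  qed
  moreover have "even t \<longleftrightarrow> even r"
    by (simp add: t)
  ultimately have "8 * (if even t then rat_of_nat (num_parts (t div 2)) else 0)
      = 8 * (if even r then if r = 0 then 3 * of_nat k - 2
             else 3 * of_nat k + of_nat (num_parts (r div 2)) else 0)"
    by simp
  then show ?thesis
    using class_poly_second_difference[OF \<open>r < 12\<close>, of "of_nat k"]
    by (simp only: t add.assoc shift)
qed

text \<open>Two consecutive values are carried through the induction because the recurrence has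
  order two.\<close>

lemma M_c_eq_quasi_poly:
  assumes "t \<ge> 1"
  shows "rat_of_nat (M_c t) = quasi_poly t \<and> rat_of_nat (M_c (t + 1)) = quasi_poly (t + 1)"
  using assms
proof (induction t rule: nat_induct_at_least)
  case base
  have "M_c 1 = 0" "M_c 2 = 0"
    by (simp_all add: M_c_eq_sum num_parts_def lessThan_nat_numeral lessThan_Suc)
  moreover have "quasi_poly 1 = 0" "quasi_poly 2 = 0"
    by (simp_all add: quasi_poly_def class_poly_def)
  ultimately show ?case
    by (simp flip: numeral_2_eq_2)
next
  case (Suc t)
  have "rat_of_nat (M_c (t + 2) + M_c t)
      = rat_of_nat (2 * M_c (t + 1) + 8 * (if even t then num_parts (t div 2) else 0))"
    by (simp only: M_c_second_difference)
  then have "rat_of_nat (M_c (t + 2)) = 2 * rat_of_nat (M_c (t + 1)) - rat_of_nat (M_c t)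
      + 8 * (if even t then of_nat (num_parts (t div 2)) else 0)"
    by (simp split: if_splits)
  also have "\<dots> = quasi_poly (t + 2)"
    using Suc quasi_poly_second_difference[of t] by simp
  finally show ?case
    using Suc by simp
qed

section \<open>The generating function\<close>

text \<open>The characteristic polynomial is x^5 - x^3 - x^2 + 1 = (x^2 - 1)(x^3 - 1). The first
  factor turns floor((s - 1) / 2) into a constant, and the second kills constants and the indicator
  of 3 | s.\<close>

lemma num_parts_recurrence:
  assumes "k > 0"
  shows "num_parts (k + 5) + num_parts k = num_parts (k + 3) + num_parts (k + 2)"
proof -
  \<comment> \<open>Residues are taken from 1 to 6, since \<open>num_parts_add_mult_6\<close>
    requires a positive argument.\<close>
  define q r where "q = (k - 1) div 6" and "r = (k - 1) mod 6 + 1"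
  then have k: "k = 6 * q + r" and "r > 0" and "r < 7"
    using assms by auto
  from \<open>r > 0\<close> \<open>r < 7\<close> have "r \<in> {1,2,3,4,5,6}"
    by (auto simp: eval_nat_numeral less_Suc_eq)
  then have "num_parts (r + 5) + num_parts r = num_parts (r + 3) + num_parts (r + 2)"
    by (elim insertE emptyE) (simp_all add: num_parts_def, simp add: numeral_3_eq_3)
  then show ?thesis
    using \<open>r > 0\<close> by (simp only: k add.assoc num_parts_add_mult_6 add_pos_pos zero_less_numeral)
qed

text \<open>Multiplying by (1 - x)^2 takes second differences. As \<open>H\<close> is a series in
  x^2, the factors x^2 - 1 and x^3 - 1 of the recurrence for \<open>num_parts\<close> become 1 - x^4
  and 1 - x^6.\<close>

lemma fps_M_c:
  fixes F H :: "rat fps"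
  defines "F \<equiv> Abs_fps (\<lambda>t. of_nat (M_c t))"
    and "H \<equiv> Abs_fps (\<lambda>n. if even n then of_nat (num_parts (n div 2)) else 0)"
  shows "F * (1 - fps_X) ^ 2 = 8 * fps_X ^ 2 * H"
    and "H * ((1 - fps_X ^ 4) * (1 - fps_X ^ 6)) = fps_X ^ 8 * (2 * fps_X ^ 2 + 1)"
proof -
  have "F * (1 - fps_X) ^ 2 = F - 2 * (fps_X ^ 1 * F) + fps_X ^ 2 * F"
    by (simp add: power2_eq_square algebra_simps)
  also have "\<dots> = 8 * (fps_X ^ 2 * H)"
  proof (rule fps_ext)
    fix n :: nat
    consider "n = 0" | "n = 1" | t where "n = t + 2"
      by (metis One_nat_def add_2_eq_Suc' not0_implies_Suc)
    then show "fps_nth (F - 2 * (fps_X ^ 1 * F) + fps_X ^ 2 * F) n = fps_nth (8 * (fps_X ^ 2 * H)) n"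
    proof cases
      case (3 t)
      have "rat_of_nat (M_c (t + 2) + M_c t)
          = rat_of_nat (2 * M_c (t + 1) + 8 * (if even t then num_parts (t div 2) else 0))"
        by (simp only: M_c_second_difference)
      with 3 show ?thesis
        by (simp add: F_def H_def fps_X_power_mult_nth numeral_fps_const split: if_splits)
    qed (simp_all add: F_def H_def M_c_eq_sum num_parts_def fps_X_power_mult_nth numeral_fps_const)
  qed
  finally show "F * (1 - fps_X) ^ 2 = 8 * fps_X ^ 2 * H"
    by (simp add: mult.assoc)
  have "H * ((1 - fps_X ^ 4) * (1 - fps_X ^ 6))
      = H - fps_X ^ 4 * H - fps_X ^ 6 * H + fps_X ^ 10 * H"
    by (simp add: algebra_simps flip: power_add)
  also have "\<dots> = 2 * fps_X ^ 10 + fps_X ^ 8"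
  proof (rule fps_ext)
    fix n
    show "fps_nth (H - fps_X ^ 4 * H - fps_X ^ 6 * H + fps_X ^ 10 * H) n
        = fps_nth (2 * fps_X ^ 10 + fps_X ^ 8 :: rat fps) n"
    proof (cases "n \<le> 10")
      case True
      then have "n \<in> {0,1,2,3,4,5,6,7,8,9,10}"
        by (simp add: eval_nat_numeral le_Suc_eq)
      then show ?thesis
        by (elim insertE emptyE)
          (simp_all add: H_def num_parts_def fps_X_power_mult_nth numeral_fps_const)
    next
      case False
      show ?thesis
      proof (cases "even n")
        case True
        define k where "k = n div 2 - 5"
        have n: "n = 2 * (k + 5)" and "k > 0"
          using False True by (auto simp: k_def)
        have "rat_of_nat (num_parts (k + 5) + num_parts k) = rat_of_nat (num_parts (k + 3) + num_parts (k + 2))"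
          by (simp only: num_parts_recurrence[OF \<open>k > 0\<close>])
        moreover have "(n - 4) div 2 = k + 3" "(n - 6) div 2 = k + 2" "(n - 10) div 2 = k" "n div 2 = k + 5"
          using n by simp_all
        ultimately show ?thesis
          using True False by (simp add: H_def fps_X_power_mult_nth numeral_fps_const)
      qed (use False in \<open>simp add: H_def fps_X_power_mult_nth numeral_fps_const\<close>)
    qed
  qed
  also have "\<dots> = fps_X ^ 8 * (2 * fps_X ^ 2 + 1)"
    by (simp add: algebra_simps flip: power_add)
  finally show "H * ((1 - fps_X ^ 4) * (1 - fps_X ^ 6)) = fps_X ^ 8 * (2 * fps_X ^ 2 + 1)" .
qed

theorem mainTheorem1:
  shows "Abs_fps (\<lambda>t. if t > 0 then of_nat (M_c t) else 0 :: rat) =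
           8 * fps_X ^ 10 * (2 * fps_X ^ 2 + 1) /
             ((1 - fps_X) ^ 2 * (1 - fps_X ^ 4) * (1 - fps_X ^ 6))
    \<and> (\<forall>t\<ge>1.
         (t mod 12 \<in> {0, 2, 6, 8} \<longrightarrow>
            rat_of_nat (M_c t) = (of_nat t ^ 3 - 16 * of_nat t ^ 2 + 76 * of_nat t - 96) / 6) \<and>
         (t mod 12 = 1 \<longrightarrow>
            rat_of_nat (M_c t) = (of_nat t ^ 3 - 16 * of_nat t ^ 2 + 73 * of_nat t - 58) / 6) \<and>
         (t mod 12 \<in> {3, 11} \<longrightarrow>
            rat_of_nat (M_c t) = (of_nat t ^ 3 - 16 * of_nat t ^ 2 + 73 * of_nat t - 102) / 6) \<and>
         (t mod 12 \<in> {4, 10} \<longrightarrow>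
            rat_of_nat (M_c t) = (of_nat t ^ 3 - 16 * of_nat t ^ 2 + 76 * of_nat t - 112) / 6) \<and>
         (t mod 12 \<in> {5, 9} \<longrightarrow>
            rat_of_nat (M_c t) = (of_nat t ^ 3 - 16 * of_nat t ^ 2 + 73 * of_nat t - 90) / 6) \<and>
         (t mod 12 = 7 \<longrightarrow>
            rat_of_nat (M_c t) = (of_nat t ^ 3 - 16 * of_nat t ^ 2 + 73 * of_nat t - 70) / 6))"
proof (intro conjI allI impI)
  let ?F = "Abs_fps (\<lambda>t. of_nat (M_c t)) :: rat fps"
  let ?H = "Abs_fps (\<lambda>n. if even n then of_nat (num_parts (n div 2)) else 0) :: rat fps"
  let ?D = "(1 - fps_X) ^ 2 * (1 - fps_X ^ 4) * (1 - fps_X ^ 6) :: rat fps"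
  have "?F * ?D = ?F * (1 - fps_X) ^ 2 * ((1 - fps_X ^ 4) * (1 - fps_X ^ 6))"
    by (simp only: mult.assoc)
  also have "\<dots> = 8 * fps_X ^ 2 * (?H * ((1 - fps_X ^ 4) * (1 - fps_X ^ 6)))"
    by (simp only: fps_M_c(1) mult.assoc)
  also have "\<dots> = 8 * fps_X ^ 10 * (2 * fps_X ^ 2 + 1)"
    by (simp only: fps_M_c(2)) (simp add: mult.assoc flip: power_add)
  finally have eq: "?F * ?D = 8 * fps_X ^ 10 * (2 * fps_X ^ 2 + 1)" .
  have "fps_nth ?D 0 \<noteq> 0"
    by (simp add: fps_nth_power_0)
  then have "?D \<noteq> 0"
    by (metis fps_zero_nth)
  then have "?F = 8 * fps_X ^ 10 * (2 * fps_X ^ 2 + 1) / ?D"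
    unfolding eq[symmetric] by (rule nonzero_mult_div_cancel_right[symmetric])
  \<comment> \<open>The coefficients at t = 0 agree because \<open>M_c 0 = 0\<close>.\<close>
  moreover have "?F = Abs_fps (\<lambda>t. if t > 0 then of_nat (M_c t) else 0)"
    by (rule fps_ext) (simp add: M_c_eq_sum)
  ultimately show "Abs_fps (\<lambda>t. if t > 0 then of_nat (M_c t) else 0 :: rat)
      = 8 * fps_X ^ 10 * (2 * fps_X ^ 2 + 1) / ?D"
    by simp
qed (auto simp: M_c_eq_quasi_poly quasi_poly_def class_poly_def)

end
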